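(* Let $\Omega\subseteq\mathbb{R}^n$ and $f:\Omega\to\mathbb{R}^n$ with solution map $\phi_f$, let $G\subseteq\Omega$ be forward invariant for $f$, and let $\alpha_1,\alpha_2:G\to\mathbb{R}_+$ be continuous. Let $\beta:\mathbb{R}_+\times\mathbb{R}_+\to\mathbb{R}_+$ be normalized and time-invariant. If there exists $V:G\to\mathbb{R}_+$ such that for all $x\in G$ $$\alpha_1(x)\le V(x)\le \alpha_2(x),\qquad V(\phi_f(x,t))\le \beta(V(x),t)\quad\forall t\ge 0,$$ then $f$ is $\beta$-stable on $G$ with respect to $\alpha_1,\alpha_2$, i.e. $\alpha_1(\phi_f(x,t))\le\beta(\alpha_2(x),t)$ for all $x\in G$ and $t\ge 0$.
   Context: $\mathbb{R}_+=[0,\infty)$. For $f:\Omega\to\mathbb{R}^n$, $\phi_f$ denotes the solution map of the ODE: $\partial_t\phi_f(x,t)=f(\phi_f(x,t))$, $\phi_f(x,0)=x$. Standing assumption: $\phi_f$ is well-defined, unique (for finite-time stable systems, uniqueness may be relaxed at the origin only), jointly continuous in $(x,t)$, and satisfies $\phi_f(\phi_f(x,t),s)=\phi_f(x,t+s)$ for $t,s\ge0$. $G\subseteq\Omega$ is forward invariant for $f$ if $\phi_f(x,t)\in G$ for all $x\in G$, $t\ge 0$. $\beta:\mathbb{R}_+\times\mathbb{R}_+\to\mathbb{R}_+$ is normalized if $\beta(y,0)=y$ for all $y\ge0$; it is time-invariant if $\beta$ is continuous and for all $y,z,t_0\ge0$, $\beta(y,t_0)=\beta(z,0)$ implies $\beta(y,t_0+t)=\beta(z,t)$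 for all $t\ge0$. *)

theory Defs
  imports "HOL-Analysis.Analysis"
begin

text \<open>
  Functions with a restricted domain (such as a vector field on \<open>\<Omega>\<close>, or a map on
  \<open>[0,\<infinity>) \<times> [0,\<infinity>)\<close>) are represented by total functions; only their values on the
  intended domain are ever constrained.
\<close>

definition ode_solution_on ::
    "(real^'n) set \<Rightarrow> (real^'n \<Rightarrow> real^'n) \<Rightarrow> real^'n \<Rightarrow> real set \<Rightarrow> (real \<Rightarrow> real^'n) \<Rightarrow> bool" where
  "ode_solution_on \<Omega> f x J u \<longleftrightarrow>
     u 0 = x \<and> (\<forall>t\<in>J. u t \<in> \<Omega> \<and> (u has_vector_derivative f (u t)) (at t within J))"

text \<open>
  The last conjunct is uniqueness in forward time: every solution starting at \<open>x\<close> agrees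
  with \<open>\<phi> x\<close> at least until it first reaches the origin. Branching at the origin is allowed
  for every system, not only for finite-time stable ones; ordinary uniqueness is a special case.
\<close>

definition is_solution_map ::
    "(real^'n) set \<Rightarrow> (real^'n \<Rightarrow> real^'n) \<Rightarrow> (real^'n \<Rightarrow> real \<Rightarrow> real^'n) \<Rightarrow> bool" where
  "is_solution_map \<Omega> f \<phi> \<longleftrightarrow>
     (\<forall>x\<in>\<Omega>. ode_solution_on \<Omega> f x {0..} (\<phi> x)) \<and>
     continuous_on (\<Omega> \<times> {0..}) (\<lambda>(x, t). \<phi> x t) \<and>
     (\<forall>x\<in>\<Omega>. \<forall>t\<ge>0. \<forall>s\<ge>0. \<phi> (\<phi> x t) s = \<phi> x (t + s)) \<and>
     (\<forall>x\<in>\<Omega>. \<forall>T\<ge>0. \<forall>u. ode_solution_on \<Omega> f x {0..T} u \<longrightarrow>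
        (\<forall>t\<in>{0..T}. (\<forall>s\<in>{0..<t}. u s \<noteq> 0) \<longrightarrow> u t = \<phi> x t))"

definition forward_invariant :: "(real^'n \<Rightarrow> real \<Rightarrow> real^'n) \<Rightarrow> (real^'n) set \<Rightarrow> bool" where
  "forward_invariant \<phi> G \<longleftrightarrow> (\<forall>x\<in>G. \<forall>t\<ge>0. \<phi> x t \<in> G)"

definition normalized :: "(real \<Rightarrow> real \<Rightarrow> real) \<Rightarrow> bool" where
  "normalized \<beta> \<longleftrightarrow> (\<forall>y\<ge>0. \<beta> y 0 = y)"

definition time_invariant :: "(real \<Rightarrow> real \<Rightarrow> real) \<Rightarrow> bool" where
  "time_invariant \<beta> \<longleftrightarrow>
     continuous_on ({0..} \<times> {0..}) (\<lambda>(y, t). \<beta> y t) \<and>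
     (\<forall>y\<ge>0. \<forall>z\<ge>0. \<forall>t0\<ge>0. \<beta> y t0 = \<beta> z 0 \<longrightarrow> (\<forall>t\<ge>0. \<beta> y (t0 + t) = \<beta> z t))"

text \<open>Stability of a vector field is expressed through its solution map \<open>\<phi>\<close>.\<close>

definition beta_stable_on ::
    "(real^'n \<Rightarrow> real \<Rightarrow> real^'n) \<Rightarrow> (real \<Rightarrow> real \<Rightarrow> real) \<Rightarrow> (real^'n) set \<Rightarrow>
     (real^'n \<Rightarrow> real) \<Rightarrow> (real^'n \<Rightarrow> real) \<Rightarrow> bool" where
  "beta_stable_on \<phi> \<beta> G \<alpha>1 \<alpha>2 \<longleftrightarrow> (\<forall>x\<in>G. \<forall>t\<ge>0. \<alpha>1 (\<phi> x t) \<le> \<beta> (\<alpha>2 x) t)"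

end

theory Submission
  imports Defs
begin

text \<open>
  The estimate on \<open>V\<close> gives \<open>\<alpha>1 (\<phi> x t) \<le> V (\<phi> x t) \<le> \<beta> (V x) t\<close>, and the only thing left is to
  replace \<open>V x\<close> by the larger number \<open>\<alpha>2 x\<close>. So the content of the theorem is that \<open>\<beta>\<close> is
  monotone in its first argument (\<open>normalized_time_invariant_mono\<close>), although neither defining
  property mentions the order. A normalized, time-invariant \<open>\<beta>\<close> is a continuous semiflow on the
  half-line \<open>[0,\<infinity>)\<close>: the value \<open>\<beta> y s\<close> determines \<open>\<beta> y t\<close> for every \<open>t \<ge> s\<close>. Two of its
  trajectories therefore merge once they meet, and on a line one continuous trajectory cannot
  overtake another without meeting it.
\<close>

text \<open>
  The common value is itself an initial value, because \<open>\<beta>\<close> is normalized; time invariance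
  identifies both later trajectories with the one that starts there.
\<close>

lemma normalized_time_invariant_merge:
  assumes norm: "normalized \<beta>" and ti: "time_invariant \<beta>"
    and nonneg: "\<forall>y\<ge>0. \<forall>t\<ge>0. 0 \<le> \<beta> y t"
    and "0 \<le> a" "0 \<le> b" "0 \<le> s" "s \<le> t" and meet: "\<beta> a s = \<beta> b s"
  shows "\<beta> a t = \<beta> b t"
proof -
  have restart: "\<beta> y t = \<beta> (\<beta> y s) (t - s)" if "0 \<le> y" for y
  proof -
    have z: "0 \<le> \<beta> y s"
      using nonneg that \<open>0 \<le> s\<close> by blast
    then have "\<beta> y s = \<beta> (\<beta> y s) 0"
      using norm by (simp add: normalized_def)
    then have "\<beta> y (s + (t - s)) = \<beta> (\<beta> y s) (t - s)"
      using ti that z \<open>0 \<le> s\<close> \<open>s \<le> t\<close> unfolding time_invariant_def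
      by (metis diff_ge_0_iff_ge)
    then show ?thesis by simp
  qed
  show ?thesis
    using restart[OF \<open>0 \<le> a\<close>] restart[OF \<open>0 \<le> b\<close>] meet by simp
qed

lemma time_invariant_continuous_on_trajectory:
  assumes "time_invariant \<beta>" and "0 \<le> y"
  shows "continuous_on {0..} (\<beta> y)"
proof -
  have "continuous_on {0..} (\<lambda>t. (\<lambda>(y, t). \<beta> y t) (y, t))"
    by (rule continuous_on_compose2[where t = "{0..} \<times> {0..}"])
      (use assms in \<open>auto simp: time_invariant_def intro!: continuous_intros\<close>)
  then show ?thesis by simp
qed

text \<open>
  If the order of two trajectories were reversed at time \<open>t\<close>, the intermediate value theorem would
  give an earlier meeting time, after which the trajectories agree.
\<close>

lemma normalized_time_invariant_mono:
  assumes norm: "normalized \<beta>" and ti: "time_invariant \<beta>"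
    and nonneg: "\<forall>y\<ge>0. \<forall>t\<ge>0. 0 \<le> \<beta> y t"
    and "0 \<le> a" "a \<le> b" "0 \<le> t"
  shows "\<beta> a t \<le> \<beta> b t"
proof (rule ccontr)
  assume "\<not> \<beta> a t \<le> \<beta> b t"
  then have overtaken: "0 \<le> \<beta> a t - \<beta> b t" "\<beta> a t \<noteq> \<beta> b t"
    by auto
  have "0 \<le> b"
    using \<open>0 \<le> a\<close> \<open>a \<le> b\<close> by simp
  have "\<beta> a 0 - \<beta> b 0 \<le> 0"
    using norm \<open>0 \<le> a\<close> \<open>0 \<le> b\<close> \<open>a \<le> b\<close> by (simp add: normalized_def)
  moreover have "continuous_on {0..t} (\<lambda>s. \<beta> a s - \<beta> b s)"
    using time_invariant_continuous_on_trajectory[OF ti \<open>0 \<le> a\<close>]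
      time_invariant_continuous_on_trajectory[OF ti \<open>0 \<le> b\<close>]
    by (intro continuous_on_diff) (auto intro: continuous_on_subset)
  ultimately obtain s where "0 \<le> s" "s \<le> t" "\<beta> a s - \<beta> b s = 0"
    using IVT'[of "\<lambda>s. \<beta> a s - \<beta> b s" 0 0 t] overtaken(1) \<open>0 \<le> t\<close> by blast
  then have "\<beta> a t = \<beta> b t"
    using normalized_time_invariant_merge[OF norm ti nonneg \<open>0 \<le> a\<close> \<open>0 \<le> b\<close>, of s t] by simp
  with overtaken(2) show False by simp
qed

theorem theorem12:
  fixes \<Omega> G :: "(real^'n) set"
    and f :: "real^'n \<Rightarrow> real^'n"
    and \<phi> :: "real^'n \<Rightarrow> real \<Rightarrow> real^'n"
    and \<alpha>1 \<alpha>2 :: "real^'n \<Rightarrow> real"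
    and \<beta> :: "real \<Rightarrow> real \<Rightarrow> real"
  assumes "is_solution_map \<Omega> f \<phi>"
    and "G \<subseteq> \<Omega>" and "forward_invariant \<phi> G"
    and "continuous_on G \<alpha>1" and "\<forall>x\<in>G. 0 \<le> \<alpha>1 x"
    and "continuous_on G \<alpha>2" and "\<forall>x\<in>G. 0 \<le> \<alpha>2 x"
    and "\<forall>y\<ge>0. \<forall>t\<ge>0. 0 \<le> \<beta> y t"
    and "normalized \<beta>" and "time_invariant \<beta>"
    and "\<exists>V :: real^'n \<Rightarrow> real. \<forall>x\<in>G. 0 \<le> V x \<and> \<alpha>1 x \<le> V x \<and> V x \<le> \<alpha>2 x \<and>
           (\<forall>t\<ge>0. V (\<phi> x t) \<le> \<beta> (V x) t)"
  shows "beta_stable_on \<phi> \<beta> G \<alpha>1 \<alpha>2"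
proof -
  obtain V where V: "\<And>x. x \<in> G \<Longrightarrow> 0 \<le> V x" "\<And>x. x \<in> G \<Longrightarrow> \<alpha>1 x \<le> V x"
      "\<And>x. x \<in> G \<Longrightarrow> V x \<le> \<alpha>2 x"
      "\<And>x t. x \<in> G \<Longrightarrow> 0 \<le> t \<Longrightarrow> V (\<phi> x t) \<le> \<beta> (V x) t"
    using assms(11) by blast
  have "\<alpha>1 (\<phi> x t) \<le> \<beta> (\<alpha>2 x) t" if "x \<in> G" "0 \<le> t" for x t
  proof -
    have "\<phi> x t \<in> G"
      using \<open>forward_invariant \<phi> G\<close> that by (simp add: forward_invariant_def)
    then have "\<alpha>1 (\<phi> x t) \<le> V (\<phi> x t)" by (rule V(2))
    also have "\<dots> \<le> \<beta> (V x) t" using that by (rule V(4))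
    also have "\<dots> \<le> \<beta> (\<alpha>2 x) t"
      using normalized_time_invariant_mono[OF assms(9,10,8) V(1)[OF that(1)] V(3)[OF that(1)] that(2)] .
    finally show ?thesis .
  qed
  then show ?thesis by (simp add: beta_stable_on_def)
qed

end
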